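(* Let $\mathbb{M}$ be a complete MV-chain, let $Y, Z$ be finite sets, let $f:\mathbb{M}^Y\to\mathbb{M}^Z$ be a non-expansive function and let $a\in\mathbb{M}^Y$. Then for all $\delta\in\mathbb{M}$ with $0\sqsubset\delta$: (a) $\gamma_{f(a),\delta}\circ f\subseteq f_a^{\#}\circ\gamma_{a,\delta}$, i.e. $\gamma_{f(a),\delta}(f(b))\subseteq f_a^{\#}(\gamma_{a,\delta}(b))$ for all $b\in[a,a\oplus\delta]$; (b) if $\delta\sqsubseteq\delta_a$, then $\delta\sqsubseteq\iota_a^f$ if and only if $\gamma_{f(a),\delta}\circ f=f_a^{\#}\circ\gamma_{a,\delta}$ as functions on $[a,a\oplus\delta]$.
   Context: MV-algebras: an MV-algebra is a tuple $\mathbb{M}=(M,\oplus,0,\overline{(\cdot)})$ where $(M,\oplus,0)$ is a commutative monoid and $\overline{(\cdot)}:M\to M$ satisfies $\overline{\overline{x}}=x$, $x\oplus\overline{0}=\overline{0}$ and $\overline{(\overline{x}\oplus y)}\oplus y=\overline{(\overline{y}\oplus x)}\oplus x$ for all $x,y$. Put $1=\overline{0}$, $x\otimes y=\overline{\overline{x}\oplus\overline{y}}$, $x\ominus y=x\otimes\overline{y}$. The natural order is $x\sqsubseteq y$ iff $x\oplus z=y$ for some $z$; it is a lattice order with bottom $0$ and top $1$; $x\sqsubset y$ means $x\sqsubseteq y$ and $x\neq y$. $\mathbb{M}$ is an MV-chain if $\sqsubseteq$ is total, and complete if $(M,\sqsubseteq)$ is a complete lattice. Function spaces: $\mathbb{M}^Y$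 is the set of functions $Y\to M$ with pointwise order and operations; $[b,c]=\{d\mid b\sqsubseteq d\sqsubseteq c\}$. For $Y'\subseteq Y$, $\delta\in\mathbb{M}$, $\delta_{Y'}$ is the function with value $\delta$ on $Y'$ and $0$ elsewhere; $\delta$ also denotes the constant function $\delta_Y$. The norm is $\|a\|=\max\{a(y)\mid y\in Y\}$. A function $f:\mathbb{M}^Y\to\mathbb{M}^Z$ is non-expansive if $\|f(b)\ominus f(a)\|\sqsubseteq\|b\ominus a\|$ for all $a,b\in\mathbb{M}^Y$. Such $f$ is monotone and maps $[a,a\oplus\delta]$ into $[f(a),f(a)\oplus\delta]$. Approximations: for $a\in\mathbb{M}^Y$ let $[Y]_a=\{y\in Y\mid a(y)\neq 1\}$ and $\delta_a=\min\{\overline{a(y)}\mid y\in[Y]_a\}$ with $\min\emptyset=1$. For $\delta\in\mathbb{M}$ let $\alpha_{a,\delta}:\mathbf{2}^{[Y]_a}\to[a,a\oplus\delta]$, $\alpha_{a,\delta}(Y')=a\oplus\delta_{Y'}$, and $\gamma_{a,\delta}:[a,a\oplus\delta]\to\mathbf{2}^{[Y]_a}$, $\gamma_{a,\delta}(b)=\{y\in[Y]_a\mid b(y)\ominus a(y)\sqsupseteq\delta\}$; $\gamma_{f(a),\delta}$ is defined likewise for $f(a)\in\mathbb{M}^Z$. For non-expansive $f$ put $f_{a,\delta}^{\#}=\gamma_{f(a),\delta}\circ f\circ\alpha_{a,\delta}:\mathbf{2}^{[Y]_a}\to\mathbf{2}^{[Z]_{f(a)}}$. For $Y'\subseteq[Y]_a$,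 $z\in[Z]_{f(a)}$ let $\iota_a^f(Y',z)=\max\{\theta\in\mathbb{M}\mid z\in f_{a,\theta}^{\#}(Y')\}$ (the maximum exists when $\mathbb{M}$ is a complete MV-chain), and $\iota_a^f=\min\big(\{\iota_a^f(Y',z)\mid Y'\subseteq[Y]_a,\ z\in[Z]_{f(a)},\ \iota_a^f(Y',z)\neq 0\}\cup\{\delta_a\}\big)$. The $a$-approximation of $f$ is $f_a^{\#}=f_{a,\iota_a^f}^{\#}$. *)

theory Defs
  imports Main "HOL-Library.FuncSet"
begin

text \<open>
  The monoid operation of an MV-algebra is written \<open>+\<close> and its complement \<open>- x\<close>.
  There is no subtraction or cancellation: \<open>x + - x\<close> is the top element.
\<close>

class mv_algebra = comm_monoid_add + uminus +
  assumes mv_compl_compl: "- (- x) = x"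
    and mv_add_top: "x + - 0 = - 0"
    and mv_lukasiewicz: "- (- x + y) + y = - (- y + x) + x"

definition mv_one :: "'m::mv_algebra" ("\<one>")
  where "\<one> = - 0"

definition otimes :: "'m::mv_algebra \<Rightarrow> 'm \<Rightarrow> 'm" (infixl "\<otimes>" 70)
  where "x \<otimes> y = - (- x + - y)"

definition ominus :: "'m::mv_algebra \<Rightarrow> 'm \<Rightarrow> 'm" (infixl "\<ominus>" 65)
  where "x \<ominus> y = x \<otimes> - y"

text \<open>
  The last axiom forces \<open>\<le>\<close> to be the natural order of the MV-algebra; being a complete
  linear order is then a property of the MV-algebra, since the other lattice operations
  are determined by \<open>\<le>\<close>.
\<close>

class complete_mv_chain = mv_algebra + complete_linorder +
  assumes mv_natural_order: "x \<le> y \<longleftrightarrow> (\<exists>z. x + z = y)"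

text \<open>
  The index sets are explicit (and possibly empty) finite sets; the elements of \<open>\<M>\<^sup>Y\<close>
  are represented by extensional functions.
\<close>

definition fspace :: "'y set \<Rightarrow> ('y \<Rightarrow> 'm) set"
  where "fspace Y = Y \<rightarrow>\<^sub>E UNIV"

definition fplus :: "'y set \<Rightarrow> ('y \<Rightarrow> 'm::mv_algebra) \<Rightarrow> ('y \<Rightarrow> 'm) \<Rightarrow> 'y \<Rightarrow> 'm"
  where "fplus Y a b = (\<lambda>y\<in>Y. a y + b y)"

definition fminus :: "'y set \<Rightarrow> ('y \<Rightarrow> 'm::mv_algebra) \<Rightarrow> ('y \<Rightarrow> 'm) \<Rightarrow> 'y \<Rightarrow> 'm"
  where "fminus Y a b = (\<lambda>y\<in>Y. a y \<ominus> b y)"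

definition step :: "'y set \<Rightarrow> 'm::mv_algebra \<Rightarrow> 'y set \<Rightarrow> 'y \<Rightarrow> 'm"
  where "step Y \<delta> Y' = (\<lambda>y\<in>Y. if y \<in> Y' then \<delta> else 0)"

definition interval :: "'y set \<Rightarrow> ('y \<Rightarrow> 'm::complete_mv_chain) \<Rightarrow> ('y \<Rightarrow> 'm) \<Rightarrow> ('y \<Rightarrow> 'm) set"
  where "interval Y b c = {d \<in> fspace Y. \<forall>y\<in>Y. b y \<le> d y \<and> d y \<le> c y}"

text \<open>The maximum over the empty index set is taken to be \<open>0\<close>, the least element.\<close>

definition mv_norm :: "'y set \<Rightarrow> ('y \<Rightarrow> 'm::complete_mv_chain) \<Rightarrow> 'm"
  where "mv_norm Y a = (if Y = {} then 0 else Max (a ` Y))"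

definition nonexpansive ::
  "'y set \<Rightarrow> 'z set \<Rightarrow> (('y \<Rightarrow> 'm::complete_mv_chain) \<Rightarrow> 'z \<Rightarrow> 'm) \<Rightarrow> bool"
  where "nonexpansive Y Z f \<longleftrightarrow>
    (\<forall>a\<in>fspace Y. \<forall>b\<in>fspace Y.
       mv_norm Z (fminus Z (f b) (f a)) \<le> mv_norm Y (fminus Y b a))"

text \<open>\<open>non_top Y a\<close> is \<open>[Y]\<^sub>a\<close> and \<open>slack Y a\<close> is \<open>\<delta>\<^sub>a\<close>.\<close>

definition non_top :: "'y set \<Rightarrow> ('y \<Rightarrow> 'm::mv_algebra) \<Rightarrow> 'y set"
  where "non_top Y a = {y \<in> Y. a y \<noteq> \<one>}"

definition slack :: "'y set \<Rightarrow> ('y \<Rightarrow> 'm::complete_mv_chain) \<Rightarrow> 'm"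
  where "slack Y a =
    (if non_top Y a = {} then \<one> else Min ((\<lambda>y. - a y) ` non_top Y a))"

definition alpha ::
  "'y set \<Rightarrow> ('y \<Rightarrow> 'm::mv_algebra) \<Rightarrow> 'm \<Rightarrow> 'y set \<Rightarrow> 'y \<Rightarrow> 'm"
  where "alpha Y a \<delta> Y' = fplus Y a (step Y \<delta> Y')"

definition gamma ::
  "'y set \<Rightarrow> ('y \<Rightarrow> 'm::complete_mv_chain) \<Rightarrow> 'm \<Rightarrow> ('y \<Rightarrow> 'm) \<Rightarrow> 'y set"
  where "gamma Y a \<delta> b = {y \<in> non_top Y a. \<delta> \<le> b y \<ominus> a y}"

definition approx_at ::
  "'y set \<Rightarrow> 'z set \<Rightarrow> (('y \<Rightarrow> 'm::complete_mv_chain) \<Rightarrow> 'z \<Rightarrow> 'm) \<Rightarrow> ('y \<Rightarrow> 'm) \<Rightarrow> 'm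
    \<Rightarrow> 'y set \<Rightarrow> 'z set"
  where "approx_at Y Z f a \<delta> = gamma Z (f a) \<delta> \<circ> f \<circ> alpha Y a \<delta>"

text \<open>
  The set of \<open>\<theta>\<close> maximised over is in general infinite, hence \<open>GREATEST\<close> instead of \<open>Max\<close>.
\<close>

definition iota_at ::
  "'y set \<Rightarrow> 'z set \<Rightarrow> (('y \<Rightarrow> 'm::complete_mv_chain) \<Rightarrow> 'z \<Rightarrow> 'm) \<Rightarrow> ('y \<Rightarrow> 'm)
    \<Rightarrow> 'y set \<Rightarrow> 'z \<Rightarrow> 'm"
  where "iota_at Y Z f a Y' z = (GREATEST \<theta>. z \<in> approx_at Y Z f a \<theta> Y')"

definition iota ::
  "'y set \<Rightarrow> 'z set \<Rightarrow> (('y \<Rightarrow> 'm::complete_mv_chain) \<Rightarrow> 'z \<Rightarrow> 'm) \<Rightarrow> ('y \<Rightarrow> 'm) \<Rightarrow> 'm"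
  where "iota Y Z f a =
    Min ({iota_at Y Z f a Y' z | Y' z.
            Y' \<subseteq> non_top Y a \<and> z \<in> non_top Z (f a) \<and> iota_at Y Z f a Y' z \<noteq> 0}
         \<union> {slack Y a})"

definition approx ::
  "'y set \<Rightarrow> 'z set \<Rightarrow> (('y \<Rightarrow> 'm::complete_mv_chain) \<Rightarrow> 'z \<Rightarrow> 'm) \<Rightarrow> ('y \<Rightarrow> 'm)
    \<Rightarrow> 'y set \<Rightarrow> 'z set"
  where "approx Y Z f a = approx_at Y Z f a (iota Y Z f a)"

end

theory Submission
  imports Defs
begin

text \<open>
  For fixed \<open>Y'\<close> and \<open>z\<close>, put \<open>g \<theta> = f (a + \<theta>\<^sub>Y\<^sub>') z \<ominus> f a z\<close>. Non-expansiveness makes the set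
  \<open>{\<theta>. \<theta> \<le> g \<theta>}\<close> downward closed, and monotonicity of \<open>g\<close> puts its supremum into it
  (as in the Knaster--Tarski theorem), so \<open>\<theta> \<le> \<iota>\<^sub>a\<^sup>f(Y', z)\<close> iff \<open>\<theta> \<le> g \<theta>\<close>.

  For (a), let \<open>Y'\<close> be \<open>\<gamma>(b)\<close> and let \<open>\<epsilon> < \<delta>\<close> be the largest increment \<open>b y \<ominus> a y\<close> outside \<open>Y'\<close>.
  Then \<open>b\<close> exceeds \<open>a + (\<delta> \<ominus> \<epsilon>)\<^sub>Y\<^sub>'\<close> by at most \<open>\<epsilon>\<close>, and hence \<open>\<delta> \<ominus> \<epsilon> \<le> g (\<delta> \<ominus> \<epsilon>)\<close>; so
  \<open>\<iota>\<^sub>a\<^sup>f(Y', z) \<noteq> 0\<close>, and therefore \<open>\<iota>\<^sub>a\<^sup>f \<le> \<iota>\<^sub>a\<^sup>f(Y', z)\<close>.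

  For (b), if \<open>\<delta> \<le> \<iota>\<^sub>a\<^sup>f\<close> the missing inclusion follows from downward closure and
  \<open>a + \<delta>\<^sub>Y\<^sub>' \<le> b\<close>. Conversely, evaluating the equation at \<open>b = a + \<delta>\<^sub>Y\<^sub>'\<close>, where \<open>\<gamma>(b) = Y'\<close>, turns
  \<open>\<iota>\<^sub>a\<^sup>f \<le> \<iota>\<^sub>a\<^sup>f(Y', z)\<close> into \<open>\<delta> \<le> \<iota>\<^sub>a\<^sup>f(Y', z)\<close>.
\<close>

section \<open>Arithmetic in MV-algebras and complete MV-chains\<close>

lemma mv_add_one [simp]: "x + \<one> = (\<one> :: 'm::mv_algebra)" "\<one> + x = (\<one> :: 'm)"
  by (simp_all add: mv_one_def mv_add_top add.commute)

lemma mv_compl_zero [simp]: "- (0 :: 'm::mv_algebra) = \<one>"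
  by (simp add: mv_one_def)

lemma mv_compl_one [simp]: "- (\<one> :: 'm::mv_algebra) = 0"
  using mv_compl_compl[of "0 :: 'm"] by simp

lemma mv_compl_add_self [simp]: "- x + x = (\<one> :: 'm::mv_algebra)"
  using mv_lukasiewicz[of x "\<one>"] by simp

lemma ominus_eq: "x \<ominus> y = - (- x + (y :: 'm::mv_algebra))"
  by (simp add: ominus_def otimes_def mv_compl_compl)

lemma mv_le_iff: "x \<le> y \<longleftrightarrow> - x + y = (\<one> :: 'm::complete_mv_chain)"
proof
  assume "x \<le> y"
  then obtain z where "y = x + z" using mv_natural_order by metis
  then show "- x + y = \<one>" by (simp flip: add.assoc)
next
  assume "- x + y = \<one>"
  \<comment> \<open>The left side of the axiom collapses to \<open>0 + y\<close>, so its right side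
    exhibits the witness.\<close>
  then have "x + - (- y + x) = y" using mv_lukasiewicz[of x y] by (simp add: add.commute)
  then show "x \<le> y" using mv_natural_order by blast
qed

lemma mv_zero_le [simp]: "0 \<le> (x :: 'm::complete_mv_chain)"
  by (simp add: mv_le_iff)

lemma mv_add_mono:
  fixes w x y z :: "'m::complete_mv_chain"
  assumes "w \<le> x" "y \<le> z"
  shows "w + y \<le> x + z"
proof -
  obtain u v where "w + u = x" "y + v = z" using assms mv_natural_order by metis
  then have "(w + y) + (u + v) = x + z" by (auto simp: ac_simps)
  then show ?thesis using mv_natural_order by blast
qed

text \<open>Residuation: by \<open>mv_le_iff\<close> both sides unfold to
  \<open>- x + y + z = \<one>\<close>.\<close>

lemma ominus_le_iff: "x \<ominus> y \<le> z \<longleftrightarrow> x \<le> y + (z :: 'm::complete_mv_chain)"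
  by (simp add: mv_le_iff ominus_eq mv_compl_compl add.assoc)

lemma ominus_mono_left: "x \<le> y \<Longrightarrow> x \<ominus> z \<le> y \<ominus> (z :: 'm::complete_mv_chain)"
  using ominus_le_iff[of y z "y \<ominus> z"] by (simp add: ominus_le_iff[of x])

lemma add_ominus_inverse: "x \<le> y \<Longrightarrow> x + (y \<ominus> x) = (y :: 'm::complete_mv_chain)"
  using mv_lukasiewicz[of x y] by (simp add: mv_le_iff ominus_eq add.commute)

lemma ominus_ominus_cancel:
  fixes x y :: "'m::complete_mv_chain"
  assumes "x \<le> y"
  shows "y \<ominus> (y \<ominus> x) = x"
proof -
  have "- (x + - y) + - y = - (y + - x) + - x"
    using mv_lukasiewicz[of "- x" "- y"] by (simp add: mv_compl_compl)
  also have "\<dots> = - x" using assms by (simp add: mv_le_iff add.commute)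
  finally show ?thesis by (simp add: ominus_eq mv_compl_compl add.commute)
qed

text \<open>The hypothesis excludes truncation at the top; complementing the sum reduces the claim
  to \<open>ominus_ominus_cancel\<close>.\<close>

lemma add_ominus_cancel:
  fixes x d :: "'m::complete_mv_chain"
  assumes "d \<le> - x"
  shows "(x + d) \<ominus> x = d"
proof -
  have "x + d = - (- x \<ominus> d)" by (simp add: ominus_eq mv_compl_compl)
  then have "(x + d) \<ominus> x = - x \<ominus> (- x \<ominus> d)"
    by (simp add: ominus_eq mv_compl_compl add.commute)
  then show ?thesis using ominus_ominus_cancel[OF assms] by simp
qed

section \<open>Function spaces: norm, step perturbations, slack\<close>

lemma mv_norm_ge: "finite Y \<Longrightarrow> y \<in> Y \<Longrightarrow> g y \<le> mv_norm Y g"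
  by (auto simp: mv_norm_def)

lemma mv_norm_le: "finite Y \<Longrightarrow> (\<And>y. y \<in> Y \<Longrightarrow> g y \<le> e) \<Longrightarrow> mv_norm Y g \<le> e"
  by (auto simp: mv_norm_def)

lemma nonexpansiveD:
  assumes "finite Y" "finite Z" "nonexpansive Y Z f" "a \<in> fspace Y" "b \<in> fspace Y" "z \<in> Z"
    and le: "\<And>y. y \<in> Y \<Longrightarrow> b y \<le> a y + e"
  shows "f b z \<le> f a z + e"
proof -
  have "f b z \<ominus> f a z \<le> mv_norm Z (fminus Z (f b) (f a))"
    using mv_norm_ge[of Z z "fminus Z (f b) (f a)"] assms by (simp add: fminus_def)
  also have "\<dots> \<le> mv_norm Y (fminus Y b a)"
    using assms by (auto simp: nonexpansive_def)
  also have "\<dots> \<le> e"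
    using le by (intro mv_norm_le assms) (simp add: fminus_def ominus_le_iff)
  finally show ?thesis by (simp add: ominus_le_iff)
qed

lemma alpha_in_fspace [simp]: "alpha Y a d Y' \<in> fspace Y"
  by (simp add: alpha_def fplus_def fspace_def)

lemma alpha_apply: "y \<in> Y \<Longrightarrow> alpha Y a d Y' y = a y + (if y \<in> Y' then d else 0)"
  by (simp add: alpha_def fplus_def step_def)

lemma interval_fplus_step_iff:
  "b \<in> interval Y a (fplus Y a (step Y d Y)) \<longleftrightarrow>
     b \<in> fspace Y \<and> (\<forall>y\<in>Y. a y \<le> b y \<and> b y \<le> a y + d)"
  by (auto simp: interval_def fplus_def step_def)

lemma alpha_in_interval:
  fixes a :: "'y \<Rightarrow> 'm::complete_mv_chain"
  shows "alpha Y a d Y' \<in> interval Y a (fplus Y a (step Y d Y))"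
  using mv_add_mono[of "a _" "a _" 0 d]
  by (auto simp: interval_fplus_step_iff alpha_apply)

lemma mem_approx_at_iff:
  "z \<in> approx_at Y Z f a d Y' \<longleftrightarrow>
     z \<in> non_top Z (f a) \<and> d \<le> f (alpha Y a d Y') z \<ominus> f a z"
  by (simp add: approx_at_def gamma_def)

lemma slack_le:
  assumes "finite Y" "y \<in> non_top Y a"
  shows "slack Y a \<le> - a y"
proof -
  have "finite (non_top Y a)" using assms by (simp add: non_top_def)
  then show ?thesis using assms by (auto simp: slack_def)
qed

text \<open>Below the slack no sum is truncated, so the increment is exactly \<open>d\<close> on
  \<open>Y'\<close>; elsewhere it is \<open>0 < d\<close>.\<close>

lemma gamma_alpha:
  fixes a :: "'y \<Rightarrow> 'm::complete_mv_chain"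
  assumes "finite Y" "Y' \<subseteq> non_top Y a" "0 < d" "d \<le> slack Y a"
  shows "gamma Y a d (alpha Y a d Y') = Y'"
proof -
  have "(a y + d) \<ominus> a y = d" if "y \<in> non_top Y a" for y
    using slack_le[OF assms(1) that] assms(4) by (intro add_ominus_cancel) auto
  moreover have "\<not> d \<le> a y \<ominus> a y" for y
    using assms(3) by (simp add: ominus_eq)
  moreover have "y \<in> Y" if "y \<in> non_top Y a" for y using that by (simp add: non_top_def)
  ultimately show ?thesis using assms(2)
    by (auto simp: gamma_def alpha_apply split: if_splits)
qed

section \<open>Approximations of a non-expansive map\<close>

context
  fixes Y :: "'y set" and Z :: "'z set"
    and f :: "('y \<Rightarrow> 'm::complete_mv_chain) \<Rightarrow> 'z \<Rightarrow> 'm"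
    and a :: "'y \<Rightarrow> 'm"
  assumes finY: "finite Y" and finZ: "finite Z"
    and nonexp: "nonexpansive Y Z f"
begin

lemma nonexpansive_mono:
  assumes "b \<in> fspace Y" "c \<in> fspace Y" "z \<in> Z" "\<And>y. y \<in> Y \<Longrightarrow> b y \<le> c y"
  shows "f b z \<le> f c z"
  using nonexpansiveD[OF finY finZ nonexp, of c b z 0] assms by simp

text \<open>Passing from \<open>b\<close> to \<open>c\<close> costs at most \<open>e\<close> of the
  increment at \<open>z\<close>. This serves both the downward closure and the nonvanishing in
  (a).\<close>

lemma le_increment_of_near:
  assumes "b \<in> fspace Y" "c \<in> fspace Y" "z \<in> Z"
    and "\<And>y. y \<in> Y \<Longrightarrow> b y \<le> c y + e"
    and "d \<le> f b z \<ominus> f a z"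
  shows "d \<ominus> e \<le> f c z \<ominus> f a z"
proof -
  have "f b z \<le> f c z + e"
    using assms by (intro nonexpansiveD[OF finY finZ nonexp]) auto
  also have "\<dots> \<le> (f a z + (f c z \<ominus> f a z)) + e"
    by (intro mv_add_mono) (simp_all flip: ominus_le_iff)
  finally have "f b z \<ominus> f a z \<le> e + (f c z \<ominus> f a z)"
    by (simp add: ominus_le_iff ac_simps)
  with assms(5) have "d \<le> e + (f c z \<ominus> f a z)" by (rule order_trans)
  then show ?thesis by (simp add: ominus_le_iff)
qed

lemma approx_at_antimono:
  assumes "d' \<le> d"
  shows "approx_at Y Z f a d Y' \<subseteq> approx_at Y Z f a d' Y'"
proof
  fix z assume z: "z \<in> approx_at Y Z f a d Y'"
  have "alpha Y a d Y' y \<le> alpha Y a d' Y' y + (d \<ominus> d')" if "y \<in> Y" for y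
    using that add_ominus_inverse[OF assms] mv_add_mono[of "a y" "a y" 0 "d \<ominus> d'"]
    by (simp add: alpha_apply add.assoc)
  \<comment> \<open>The loss is \<open>e = d \<ominus> d'\<close>; subtracting it from
    \<open>d\<close> gives back \<open>d'\<close>.\<close>
  then have "d \<ominus> (d \<ominus> d') \<le> f (alpha Y a d' Y') z \<ominus> f a z"
    using z by (intro le_increment_of_near[of "alpha Y a d Y'"])
      (auto simp: mem_approx_at_iff non_top_def)
  then show "z \<in> approx_at Y Z f a d' Y'"
    using z assms by (simp add: mem_approx_at_iff ominus_ominus_cancel)
qed

lemma le_iota_at_iff:
  assumes z: "z \<in> non_top Z (f a)"
  shows "d \<le> iota_at Y Z f a Y' z \<longleftrightarrow> z \<in> approx_at Y Z f a d Y'"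
proof -
  define s where "s = Sup {d. z \<in> approx_at Y Z f a d Y'}"
  have ub: "d \<le> s" if "z \<in> approx_at Y Z f a d Y'" for d
    using that by (auto simp: s_def intro: Sup_upper)
  have "d \<le> f (alpha Y a s Y') z \<ominus> f a z" if d: "z \<in> approx_at Y Z f a d Y'" for d
  proof -
    have "f (alpha Y a d Y') z \<le> f (alpha Y a s Y') z"
      using z ub[OF d] by (intro nonexpansive_mono) (auto simp: alpha_apply non_top_def mv_add_mono)
    then show ?thesis
      using d ominus_mono_left order_trans unfolding mem_approx_at_iff by blast
  qed
  then have "s \<le> f (alpha Y a s Y') z \<ominus> f a z"
    unfolding s_def by (intro Sup_least) (auto simp: s_def)
  then have s: "z \<in> approx_at Y Z f a s Y'" using z by (simp add: mem_approx_at_iff)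
  then have "iota_at Y Z f a Y' z = s"
    unfolding iota_at_def using ub by (rule Greatest_equality)
  then show ?thesis using ub approx_at_antimono s by blast
qed

text \<open>The set under \<open>Min\<close> contains \<open>slack Y a\<close> and is finite because
  \<open>Y\<close> and \<open>Z\<close> are, so its minimum is determined by its lower
  bounds.\<close>

lemma le_iota_iff:
  "d \<le> iota Y Z f a \<longleftrightarrow> d \<le> slack Y a \<and>
     (\<forall>Y' z. Y' \<subseteq> non_top Y a \<longrightarrow> z \<in> non_top Z (f a) \<longrightarrow> iota_at Y Z f a Y' z \<noteq> 0 \<longrightarrow>
        d \<le> iota_at Y Z f a Y' z)"
proof -
  let ?I = "{iota_at Y Z f a Y' z | Y' z.
    Y' \<subseteq> non_top Y a \<and> z \<in> non_top Z (f a) \<and> iota_at Y Z f a Y' z \<noteq> 0}"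
  have "finite (non_top Y a)" "finite (non_top Z (f a))"
    using finY finZ by (simp_all add: non_top_def)
  then have "finite ((\<lambda>(Y', z). iota_at Y Z f a Y' z) ` (Pow (non_top Y a) \<times> non_top Z (f a)))"
    by simp
  then have "finite ?I" by (rule rev_finite_subset) auto
  then show ?thesis unfolding iota_def by auto
qed

lemma iota_at_gamma_nonzero:
  assumes d: "0 < d" and b: "b \<in> interval Y a (fplus Y a (step Y d Y))"
    and z: "z \<in> gamma Z (f a) d (f b)"
  shows "iota_at Y Z f a (gamma Y a d b) z \<noteq> 0"
proof -
  define Y' where "Y' = gamma Y a d b"
  have ztop: "z \<in> non_top Z (f a)" and dz: "d \<le> f b z \<ominus> f a z"
    using z by (auto simp: gamma_def)
  have bY: "b \<in> fspace Y" and bd: "\<And>y. y \<in> Y \<Longrightarrow> b y \<le> a y + d"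
    using b by (auto simp: interval_fplus_step_iff)
  have small: "b y \<ominus> a y < d" if "y \<in> Y - Y'" for y
  \<comment> \<open>Points where \<open>a\<close> is already top never belong to
    \<open>gamma\<close>, so they lie outside \<open>Y'\<close> too; their increment is
    \<open>0\<close>.\<close>
  proof (cases "a y = \<one>")
    case True
    then show ?thesis using d by (simp add: ominus_eq)
  next
    case False
    then show ?thesis using that by (auto simp: Y'_def gamma_def non_top_def)
  qed
  \<comment> \<open>If \<open>Y' = Y\<close>, the norm takes its default \<open>0\<close>, and
    \<open>e < d\<close> is then the hypothesis \<open>0 < d\<close>.\<close>
  define e where "e = mv_norm (Y - Y') (\<lambda>y. b y \<ominus> a y)"
  have "e < d"
    using small d finY by (auto simp: e_def mv_norm_def)
  then have "0 < d \<ominus> e"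
    by (metis add_0_right linorder_not_less ominus_le_iff)
  have "b y \<le> alpha Y a (d \<ominus> e) Y' y + e" if y: "y \<in> Y" for y
  proof (cases "y \<in> Y'")
    case True
    have "d \<ominus> e + e = d" using add_ominus_inverse[of e d] \<open>e < d\<close> by (simp add: add.commute)
    then show ?thesis using True bd[OF y] y by (simp add: alpha_apply add.assoc)
  next
    case False
    have "b y \<ominus> a y \<le> e"
      unfolding e_def using y False finY mv_norm_ge[of "Y - Y'" y "\<lambda>y. b y \<ominus> a y"] by simp
    then show ?thesis using False y by (simp add: alpha_apply ominus_le_iff)
  qed
  then have "d \<ominus> e \<le> f (alpha Y a (d \<ominus> e) Y') z \<ominus> f a z"
    using bY dz ztop by (intro le_increment_of_near[of b]) (auto simp: non_top_def)
  then have "d \<ominus> e \<le> iota_at Y Z f a Y' z"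
    using ztop by (simp add: le_iota_at_iff mem_approx_at_iff)
  with \<open>0 < d \<ominus> e\<close> show ?thesis by (auto simp: Y'_def)
qed

lemma gamma_subset_approx:
  assumes "0 < d" and "b \<in> interval Y a (fplus Y a (step Y d Y))"
  shows "gamma Z (f a) d (f b) \<subseteq> approx Y Z f a (gamma Y a d b)"
proof
  fix z assume z: "z \<in> gamma Z (f a) d (f b)"
  then have ztop: "z \<in> non_top Z (f a)" by (simp add: gamma_def)
  have "gamma Y a d b \<subseteq> non_top Y a" by (auto simp: gamma_def)
  then have "iota Y Z f a \<le> iota_at Y Z f a (gamma Y a d b) z"
    using le_iota_iff[of "iota Y Z f a"] ztop iota_at_gamma_nonzero[OF assms z] by blast
  then show "z \<in> approx Y Z f a (gamma Y a d b)"
    using ztop by (simp add: approx_def le_iota_at_iff)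
qed

lemma approx_subset_gamma:
  assumes d: "d \<le> iota Y Z f a" and b: "b \<in> interval Y a (fplus Y a (step Y d Y))"
  shows "approx Y Z f a (gamma Y a d b) \<subseteq> gamma Z (f a) d (f b)"
proof
  fix z assume "z \<in> approx Y Z f a (gamma Y a d b)"
  then have z: "z \<in> approx_at Y Z f a d (gamma Y a d b)"
    using approx_at_antimono[OF d] by (auto simp: approx_def)
  have bY: "b \<in> fspace Y" and ab: "\<And>y. y \<in> Y \<Longrightarrow> a y \<le> b y"
    using b by (auto simp: interval_fplus_step_iff)
  \<comment> \<open>On the \<open>gamma\<close> set \<open>b\<close> has increment at least
    \<open>d\<close>; elsewhere \<open>a \<le> b\<close> suffices.\<close>
  have "alpha Y a d (gamma Y a d b) y \<le> b y" if "y \<in> Y" for y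
    using that ab[OF that] add_ominus_inverse[OF ab[OF that]]
      mv_add_mono[of "a y" "a y" d "b y \<ominus> a y"]
    by (auto simp: alpha_apply gamma_def)
  then have "f (alpha Y a d (gamma Y a d b)) z \<le> f b z"
    using z bY by (intro nonexpansive_mono) (auto simp: mem_approx_at_iff non_top_def)
  then show "z \<in> gamma Z (f a) d (f b)"
    using z ominus_mono_left order_trans unfolding mem_approx_at_iff gamma_def by blast
qed

lemma le_iota_of_gamma_eq_approx:
  assumes d: "0 < d" "d \<le> slack Y a"
    and eq: "\<And>b. b \<in> interval Y a (fplus Y a (step Y d Y)) \<Longrightarrow>
      gamma Z (f a) d (f b) = approx Y Z f a (gamma Y a d b)"
  shows "d \<le> iota Y Z f a"
  unfolding le_iota_iff
proof (intro conjI allI impI)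
  fix Y' z
  assume Y': "Y' \<subseteq> non_top Y a" and z: "z \<in> non_top Z (f a)"
    and nz: "iota_at Y Z f a Y' z \<noteq> 0"
  have "iota Y Z f a \<le> iota_at Y Z f a Y' z"
    using le_iota_iff[of "iota Y Z f a"] Y' z nz by blast
  \<comment> \<open>Both bounds on \<open>d\<close> enter here, through
    \<open>gamma_alpha\<close>.\<close>
  then have "z \<in> approx Y Z f a (gamma Y a d (alpha Y a d Y'))"
    using z by (simp add: approx_def le_iota_at_iff gamma_alpha[OF finY Y' d])
  then have "z \<in> gamma Z (f a) d (f (alpha Y a d Y'))"
    using eq[OF alpha_in_interval] by simp
  then show "d \<le> iota_at Y Z f a Y' z"
    by (simp add: le_iota_at_iff[OF z] approx_at_def)
qed (rule d)

end

theorem theorem3p14: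
  fixes Y :: "'y set" and Z :: "'z set"
    and f :: "('y \<Rightarrow> 'm::complete_mv_chain) \<Rightarrow> 'z \<Rightarrow> 'm"
    and a :: "'y \<Rightarrow> 'm"
  assumes "finite Y" and "finite Z"
    and "f \<in> fspace Y \<rightarrow> fspace Z"
    and "nonexpansive Y Z f"
    and "a \<in> fspace Y"
  shows "\<forall>\<delta>::'m. 0 < \<delta> \<longrightarrow>
    (\<forall>b \<in> interval Y a (fplus Y a (step Y \<delta> Y)).
        gamma Z (f a) \<delta> (f b) \<subseteq> approx Y Z f a (gamma Y a \<delta> b)) \<and>
    (\<delta> \<le> slack Y a \<longrightarrow>
      (\<delta> \<le> iota Y Z f a \<longleftrightarrow>
        (\<forall>b \<in> interval Y a (fplus Y a (step Y \<delta> Y)).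
            gamma Z (f a) \<delta> (f b) = approx Y Z f a (gamma Y a \<delta> b))))"
proof -
  note asms = assms(1,2,4)
  show ?thesis
    using gamma_subset_approx[OF asms] approx_subset_gamma[OF asms]
      le_iota_of_gamma_eq_approx[OF asms] by (meson subset_antisym)
qed

end
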